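(* Let $\mathbf{A}$ be a distributive nearlattice. If $\mathbf{A}$ is Stone, then $\mathbf{A}$ is normal.
   Context: A distributive nearlattice is a join-semilattice $\langle A,\vee,1\rangle$ with greatest element $1$ in which every principal filter $[a)=\{x\in A\colon a\le x\}$ is a bounded distributive lattice. A filter of $A$ is a subset containing $1$, upward closed, and closed under those binary meets that exist; for filters $F,G$, $F\veebar G$ is the smallest filter containing $F\cup G$. For $a\in A$, $a^{\top}=\{x\in A\colon x\vee a=1\}$ and $a^{\top\top}=\{y\in A\colon y\vee x=1\text{ for all }x\in a^{\top}\}$. $\mathbf{A}$ is Stone if $a^{\top}\veebar a^{\top\top}=A$ for every $a\in A$. An ideal is a downward closed, $\vee$-closed subset; a prime ideal is a non-empty proper ideal $P$ with $a\wedge b\in P\Rightarrow a\in P$ or $b\in P$ whenever $a\wedge b$ exists; a maximal ideal is a non-empty proper ideal not properly contained in any proper ideal. $\mathbf{A}$ is normal if each prime ideal is contained in a unique maximal ideal. *)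

theory Defs
  imports Main
begin

text \<open>Binary meets and joins are partial, so they are rendered as relations:
  \<open>is_meet_on S x y m\<close> says that \<open>m\<close> is the greatest lower bound of \<open>x\<close> and \<open>y\<close>
  in the poset \<open>S\<close> with the induced order. With \<open>S = UNIV\<close> this reads
  ``\<open>x \<and> y\<close> exists and equals \<open>m\<close>''.\<close>

definition (in order) is_meet_on :: "'a set \<Rightarrow> 'a \<Rightarrow> 'a \<Rightarrow> 'a \<Rightarrow> bool" where
  "is_meet_on S x y m \<longleftrightarrow>
     m \<in> S \<and> m \<le> x \<and> m \<le> y \<and> (\<forall>z\<in>S. z \<le> x \<and> z \<le> y \<longrightarrow> z \<le> m)"

definition (in order) is_join_on :: "'a set \<Rightarrow> 'a \<Rightarrow> 'a \<Rightarrow> 'a \<Rightarrow> bool" where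
  "is_join_on S x y j \<longleftrightarrow>
     j \<in> S \<and> x \<le> j \<and> y \<le> j \<and> (\<forall>z\<in>S. x \<le> z \<and> y \<le> z \<longrightarrow> j \<le> z)"

text \<open>The last conjunct is the distributive law \<open>x \<and> (y \<or> z) = (x \<and> y) \<or> (x \<and> z)\<close>
  in \<open>S\<close>.\<close>

definition (in order) bounded_distributive_lattice_on :: "'a set \<Rightarrow> bool" where
  "bounded_distributive_lattice_on S \<longleftrightarrow>
     (\<exists>l\<in>S. \<forall>x\<in>S. l \<le> x) \<and>
     (\<exists>u\<in>S. \<forall>x\<in>S. x \<le> u) \<and>
     (\<forall>x\<in>S. \<forall>y\<in>S. \<exists>m. is_meet_on S x y m) \<and>
     (\<forall>x\<in>S. \<forall>y\<in>S. \<exists>j. is_join_on S x y j) \<and>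
     (\<forall>x\<in>S. \<forall>y\<in>S. \<forall>z\<in>S. \<forall>j m p q.
        is_join_on S y z j \<and> is_meet_on S x j m \<and>
        is_meet_on S x y p \<and> is_meet_on S x z q \<longrightarrow> is_join_on S p q m)"

class distributive_nearlattice = semilattice_sup + order_top +
  assumes principal_filter_lattice: "bounded_distributive_lattice_on {a..}"

definition nl_filter :: "'a::distributive_nearlattice set \<Rightarrow> bool" where
  "nl_filter F \<longleftrightarrow>
     top \<in> F \<and>
     (\<forall>x y. x \<in> F \<and> x \<le> y \<longrightarrow> y \<in> F) \<and>
     (\<forall>x y m. x \<in> F \<and> y \<in> F \<and> is_meet_on UNIV x y m \<longrightarrow> m \<in> F)"

definition filter_join ::
    "'a::distributive_nearlattice set \<Rightarrow> 'a set \<Rightarrow> 'a set" where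
  "filter_join F G = \<Inter>{H. nl_filter H \<and> F \<union> G \<subseteq> H}"

definition annihilator :: "'a::distributive_nearlattice \<Rightarrow> 'a set" where
  "annihilator a = {x. sup x a = top}"

definition double_annihilator :: "'a::distributive_nearlattice \<Rightarrow> 'a set" where
  "double_annihilator a = {y. \<forall>x\<in>annihilator a. sup y x = top}"

definition stone_nearlattice :: "'a::distributive_nearlattice itself \<Rightarrow> bool" where
  "stone_nearlattice _ \<longleftrightarrow>
     (\<forall>a::'a. filter_join (annihilator a) (double_annihilator a) = UNIV)"

text \<open>The empty set counts as an ideal; prime and maximal ideals are non-empty by definition.\<close>

definition nl_ideal :: "'a::distributive_nearlattice set \<Rightarrow> bool" where
  "nl_ideal I \<longleftrightarrow>
     (\<forall>x y. y \<in> I \<and> x \<le> y \<longrightarrow> x \<in> I) \<and>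
     (\<forall>x y. x \<in> I \<and> y \<in> I \<longrightarrow> sup x y \<in> I)"

definition prime_nl_ideal :: "'a::distributive_nearlattice set \<Rightarrow> bool" where
  "prime_nl_ideal P \<longleftrightarrow>
     nl_ideal P \<and> P \<noteq> {} \<and> P \<noteq> UNIV \<and>
     (\<forall>a b m. is_meet_on UNIV a b m \<and> m \<in> P \<longrightarrow> a \<in> P \<or> b \<in> P)"

definition maximal_nl_ideal :: "'a::distributive_nearlattice set \<Rightarrow> bool" where
  "maximal_nl_ideal M \<longleftrightarrow>
     nl_ideal M \<and> M \<noteq> {} \<and> M \<noteq> UNIV \<and>
     \<not> (\<exists>J. nl_ideal J \<and> J \<noteq> UNIV \<and> M \<subset> J)"

definition normal_nearlattice :: "'a::distributive_nearlattice itself \<Rightarrow> bool" where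
  "normal_nearlattice _ \<longleftrightarrow>
     (\<forall>P::'a set. prime_nl_ideal P \<longrightarrow> (\<exists>!M. maximal_nl_ideal M \<and> P \<subseteq> M))"

end

theory Submission
  imports Defs
begin

text \<open>Suppose two distinct maximal ideals \<open>M\<close> and \<open>N\<close> contain the prime ideal \<open>P\<close>. Take
  \<open>a \<in> M - N\<close>; maximality of \<open>N\<close> gives \<open>b \<in> N\<close> with \<open>a \<or> b = 1\<close>. The complement of \<open>P\<close> is a
  proper filter, so by the Stone condition \<open>P\<close> meets the annihilator or the double annihilator
  of \<open>a\<close>: the former puts \<open>1\<close> into \<open>M\<close>, the latter, by joining with \<open>b\<close>, puts \<open>1\<close> into \<open>N\<close>.\<close>

lemma nl_ideal_proper_iff:
  assumes "nl_ideal I"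
  shows "I \<noteq> UNIV \<longleftrightarrow> top \<notin> I"
  using assms unfolding nl_ideal_def by (metis UNIV_I UNIV_eq_I top_greatest)

lemma nl_ideal_Union_chain:
  assumes "subset.chain (Collect nl_ideal) C"
  shows "nl_ideal (\<Union>C)"
  unfolding nl_ideal_def
proof (intro conjI allI impI)
  have ideals: "\<And>I. I \<in> C \<Longrightarrow> nl_ideal I"
    using assms unfolding subset.chain_def by blast
  show "x \<in> \<Union>C" if "y \<in> \<Union>C \<and> x \<le> y" for x y
    using that ideals unfolding nl_ideal_def by blast
  show "sup x y \<in> \<Union>C" if xy: "x \<in> \<Union>C \<and> y \<in> \<Union>C" for x y
  proof -
    obtain I J where IJ: "I \<in> C" "x \<in> I" "J \<in> C" "y \<in> J" using xy by blast
    have "I \<subseteq> J \<or> J \<subseteq> I"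
      using assms IJ unfolding subset_chain_def by blast
    then show ?thesis
      using IJ ideals unfolding nl_ideal_def by blast
  qed
qed

text \<open>Zorn's lemma applies once properness is read as omitting \<open>top\<close>, a condition
  that unions of chains inherit.\<close>

lemma maximal_nl_ideal_exists:
  assumes "nl_ideal I" "I \<noteq> {}" "I \<noteq> UNIV"
  shows "\<exists>M. maximal_nl_ideal M \<and> I \<subseteq> M"
proof -
  let ?S = "{J. nl_ideal J \<and> top \<notin> J \<and> I \<subseteq> J}"
  have "\<exists>M\<in>?S. \<forall>X\<in>?S. M \<subseteq> X \<longrightarrow> X = M"
  proof (rule subset_Zorn_nonempty)
    show "?S \<noteq> {}"
      using assms nl_ideal_proper_iff by blast
    fix C assume C: "C \<noteq> {}" "subset.chain ?S C"
    then have "subset.chain (Collect nl_ideal) C"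
      unfolding subset_chain_def by blast
    then have "nl_ideal (\<Union>C)" by (rule nl_ideal_Union_chain)
    \<comment> \<open>Since \<open>C\<close> is non-empty, some member of it already contains
      \<open>I\<close>, so the union does too.\<close>
    then show "\<Union>C \<in> ?S"
      using C unfolding subset_chain_def by blast
  qed
  then obtain M where "M \<in> ?S" and max: "\<And>J. J \<in> ?S \<Longrightarrow> M \<subseteq> J \<Longrightarrow> J = M"
    by (elim bexE) simp
  then have M: "nl_ideal M" "top \<notin> M" "I \<subseteq> M" by auto
  \<comment> \<open>A proper ideal above \<open>M\<close> also contains \<open>I\<close>, hence
    belongs to \<open>?S\<close>, where \<open>M\<close> is maximal.\<close>
  have "\<not> M \<subset> J" if "nl_ideal J" "J \<noteq> UNIV" for J
    using that max[of J] M(3) nl_ideal_proper_iff[of J] by auto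
  moreover have "M \<noteq> {}" "M \<noteq> UNIV"
    using M assms(2) by auto
  ultimately have "maximal_nl_ideal M"
    using M(1) unfolding maximal_nl_ideal_def by meson
  with M(3) show ?thesis by (intro exI conjI)
qed

lemma maximal_nl_ideal_complement:
  fixes N :: "'a::distributive_nearlattice set"
  assumes "maximal_nl_ideal N" "a \<notin> N"
  shows "\<exists>b\<in>N. sup a b = top"
proof -
  have N: "nl_ideal N" "N \<noteq> {}"
    using assms unfolding maximal_nl_ideal_def by auto
  \<comment> \<open>This is the ideal generated by \<open>N\<close> and \<open>a\<close>; being
    strictly larger than \<open>N\<close>, it must be improper.\<close>
  let ?J = "{x. \<exists>b\<in>N. x \<le> sup a b}"
  have "nl_ideal ?J"
    unfolding nl_ideal_def
  proof (intro conjI allI impI)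
    show "x \<in> ?J" if "y \<in> ?J \<and> x \<le> y" for x y
      using that by (auto intro: order_trans)
    show "sup x y \<in> ?J" if xy: "x \<in> ?J \<and> y \<in> ?J" for x y
    proof -
      obtain b c where bc: "b \<in> N" "x \<le> sup a b" "c \<in> N" "y \<le> sup a c" using xy by blast
      have "sup x y \<le> sup (sup a b) (sup a c)"
        using bc by (intro sup_mono)
      also have "\<dots> = sup a (sup b c)" by (simp add: ac_simps)
      finally show ?thesis
        using bc N unfolding nl_ideal_def by blast
    qed
  qed
  moreover have "N \<subset> ?J"
  proof -
    have "N \<subseteq> ?J" using sup_ge2 by blast
    moreover have "a \<in> ?J" using N(2) sup_ge1 by blast
    ultimately show ?thesis using assms(2) by blast
  qed
  ultimately have "top \<in> ?J"
    using assms(1) unfolding maximal_nl_ideal_def by blast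
  then show ?thesis
    using top_le by blast
qed

text \<open>Contraposition: properness of \<open>P\<close> yields \<open>top\<close>, downward
  closure becomes upward closure, and primeness becomes closure under existing meets.\<close>

lemma nl_filter_Compl_prime:
  assumes "prime_nl_ideal P"
  shows "nl_filter (- P)"
  unfolding nl_filter_def
proof (intro conjI allI impI)
  show "top \<in> - P"
    using assms nl_ideal_proper_iff unfolding prime_nl_ideal_def by auto
  show "y \<in> - P" if "x \<in> - P \<and> x \<le> y" for x y
    using that assms unfolding prime_nl_ideal_def nl_ideal_def by auto
  show "m \<in> - P" if "x \<in> - P \<and> y \<in> - P \<and> is_meet_on UNIV x y m" for x y m
    using that assms unfolding prime_nl_ideal_def by auto
qed

text \<open>Otherwise the filter \<open>- P\<close> would contain both sets, hence their filter
  join, which is everything; but \<open>P\<close> is non-empty.\<close>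

lemma stone_prime_meets_annihilators:
  fixes P :: "'a::distributive_nearlattice set"
  assumes "stone_nearlattice TYPE('a)" "prime_nl_ideal P"
  shows "P \<inter> (annihilator a \<union> double_annihilator a) \<noteq> {}"
proof
  assume "P \<inter> (annihilator a \<union> double_annihilator a) = {}"
  then have "filter_join (annihilator a) (double_annihilator a) \<subseteq> - P"
    using nl_filter_Compl_prime[OF assms(2)] unfolding filter_join_def by blast
  then show False
    using assms unfolding stone_nearlattice_def prime_nl_ideal_def by auto
qed

text \<open>The hypotheses are symmetric in \<open>M\<close> and \<open>N\<close>, so this inclusion
  already gives uniqueness.\<close>

lemma stone_maximal_nl_ideal_subset:
  fixes P :: "'a::distributive_nearlattice set"
  assumes stone: "stone_nearlattice TYPE('a)" and P: "prime_nl_ideal P"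
    and M: "maximal_nl_ideal M" "P \<subseteq> M" and N: "maximal_nl_ideal N" "P \<subseteq> N"
  shows "M \<subseteq> N"
proof
  fix a assume a: "a \<in> M"
  have sup_proper: "sup x y \<noteq> top" if "maximal_nl_ideal I" "x \<in> I" "y \<in> I" for I and x y :: 'a
    using that nl_ideal_proper_iff[of I] unfolding maximal_nl_ideal_def nl_ideal_def by metis
  show "a \<in> N"
  proof (rule ccontr)
    assume "a \<notin> N"
    then obtain b where b: "b \<in> N" "sup b a = top"
      using maximal_nl_ideal_complement[OF N(1)] by (metis sup_commute)
    obtain y where y: "y \<in> P" and "y \<in> annihilator a \<or> y \<in> double_annihilator a"
      using stone_prime_meets_annihilators[OF stone P] by blast
    \<comment> \<open>The choice of \<open>b\<close> puts it in \<open>annihilator a\<close>, so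
      every element of \<open>double_annihilator a\<close> joins with it to
      \<open>top\<close>.\<close>
    then have "sup y a = top \<or> sup y b = top"
      using b unfolding annihilator_def double_annihilator_def by blast
    \<comment> \<open>As \<open>y\<close> lies in both \<open>M\<close> and \<open>N\<close>, the
      first case contradicts properness of \<open>M\<close>, the second that of
      \<open>N\<close>.\<close>
    then show False
      using sup_proper M N a b y by blast
  qed
qed

theorem theorem4p8:
  assumes "stone_nearlattice TYPE('a::distributive_nearlattice)"
  shows "normal_nearlattice TYPE('a)"
  unfolding normal_nearlattice_def
proof (intro allI impI ex_ex1I)
  fix P :: "'a set" assume P: "prime_nl_ideal P"
  then show "\<exists>M. maximal_nl_ideal M \<and> P \<subseteq> M"
    using maximal_nl_ideal_exists unfolding prime_nl_ideal_def by blast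
  show "M = N" if "maximal_nl_ideal M \<and> P \<subseteq> M" "maximal_nl_ideal N \<and> P \<subseteq> N" for M N
    using that stone_maximal_nl_ideal_subset[OF assms P] by blast
qed

end
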